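(* For all integers $n,p\ge0$, \[ B_{n+1,\lambda}^{(p)}(x)=(x-n\lambda)B_{n,\lambda}^{(p)}(x)-\sum_{j=0}^{n}\binom{n}{j}(1)_{n-j,\lambda}\Big(\frac{p}{p+1}B_{j,\lambda}^{(p+1)}(x)-B_{j,\lambda}^{(p)}(x)\Big). \]
   Context: Let $\lambda\in\mathbb{R}$. Set $(x)_{0,\lambda}=1$, $(x)_{n,\lambda}=x(x-\lambda)\cdots(x-(n-1)\lambda)$ for $n\ge1$. The degenerate exponential is the formal power series $e_\lambda^x(t)=\sum_{n\ge0}(x)_{n,\lambda}\frac{t^n}{n!}$ ($=(1+\lambda t)^{x/\lambda}$, and $e^{xt}$ if $\lambda=0$), $e_\lambda(t)=e_\lambda^1(t)$. For an integer $p\ge0$, the truncated degenerate modified Bell polynomials $B^{(p)}_{n,\lambda}(x)$ are defined by \[\frac{p!}{(e_\lambda(t)-1)^p}\Big(e^{e_\lambda(t)-1}-\sum_{l=0}^{p-1}\frac{(e_\lambda(t)-1)^l}{l!}\Big)e_\lambda^x(t)=\sum_{n\ge0}B^{(p)}_{n,\lambda}(x)\frac{t^n}{n!},\] where the left side is, as a formal power series, $p!\sum_{k\ge0}\frac{(e_\lambda(t)-1)^k}{(k+p)!}e_\lambda^x(t)$. *)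

theory Defs
  imports "HOL-Computational_Algebra.Formal_Power_Series"
begin

definition deg_falling :: "real \<Rightarrow> real \<Rightarrow> nat \<Rightarrow> real" where
  "deg_falling lam x n = (\<Prod>i<n. x - of_nat i * lam)"

definition deg_exp :: "real \<Rightarrow> real \<Rightarrow> real fps" where
  "deg_exp lam x = Abs_fps (\<lambda>n. deg_falling lam x n / fact n)"

(* The outer series is composed with deg_exp lam 1 - 1, whose constant term is 0, so
   the composition is the formal sum over k of (deg_exp lam 1 - 1)^k / (k+p)!. *)
definition trunc_bell_gf :: "real \<Rightarrow> nat \<Rightarrow> real \<Rightarrow> real fps" where
  "trunc_bell_gf lam p x =
     fps_const (fact p) *
     (Abs_fps (\<lambda>k. 1 / fact (k + p)) oo (deg_exp lam 1 - 1)) * deg_exp lam x"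

definition trunc_bell :: "real \<Rightarrow> nat \<Rightarrow> nat \<Rightarrow> real \<Rightarrow> real" where
  "trunc_bell lam p n x = fact n * fps_nth (trunc_bell_gf lam p x) n"

lemma deg_exp_1_minus_1_nth_0: "fps_nth (deg_exp lam 1 - 1) 0 = 0"
  by (simp add: deg_exp_def deg_falling_def)

lemma trunc_bell_egf:
  "Abs_fps (\<lambda>n. trunc_bell lam p n x / fact n) = trunc_bell_gf lam p x"
  by (simp add: trunc_bell_def fps_eq_iff)

lemma deg_exp_1_minus_1_nonzero: "deg_exp lam 1 - 1 \<noteq> 0"
proof
  assume "deg_exp lam 1 - 1 = 0"
  then have "fps_nth (deg_exp lam 1 - 1) 1 = 0" by simp
  then show False by (simp add: deg_exp_def deg_falling_def)
qed

(* Together with the nonvanishing of deg_exp lam 1 - 1, this is the closed form of the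
   generating function with the denominator (deg_exp lam 1 - 1)^p cleared. *)
lemma trunc_bell_gf_closed_form:
  "(deg_exp lam 1 - 1) ^ p * trunc_bell_gf lam p x =
     fps_const (fact p) *
     ((fps_exp 1 oo (deg_exp lam 1 - 1)) -
        (\<Sum>l<p. fps_const (1 / fact l) * (deg_exp lam 1 - 1) ^ l)) * deg_exp lam x"
proof -
  define u where "u = deg_exp lam 1 - 1"
  have u0: "fps_nth u 0 = 0"
    unfolding u_def by (rule deg_exp_1_minus_1_nth_0)
  define H :: "real fps" where "H = Abs_fps (\<lambda>k. 1 / fact (k + p))"
  have "fps_X ^ p * H = fps_exp 1 - (\<Sum>l<p. fps_const (1 / fact l) * fps_X ^ l)"
  proof (rule fps_ext)
    fix n
    have "fps_nth (fps_X ^ p * H) n = (if n < p then 0 else 1 / fact n)"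
      by (simp add: fps_X_power_mult_nth H_def)
    moreover have "fps_nth (\<Sum>l<p. fps_const (1 / fact l :: real) * fps_X ^ l) n =
        (if n < p then 1 / fact n else 0)"
      by (simp add: fps_sum_nth fps_X_power_nth if_distrib cong: if_cong)
    ultimately show "fps_nth (fps_X ^ p * H) n =
        fps_nth (fps_exp 1 - (\<Sum>l<p. fps_const (1 / fact l) * fps_X ^ l)) n"
      by simp
  qed
  then have "(fps_X ^ p * H) oo u =
      (fps_exp 1 oo u) - (\<Sum>l<p. (fps_const (1 / fact l) * fps_X ^ l) oo u)"
    by (simp add: fps_compose_sub_distrib fps_compose_sum_distrib)
  then have "u ^ p * (H oo u) =
      (fps_exp 1 oo u) - (\<Sum>l<p. fps_const (1 / fact l) * u ^ l)"
    using u0 by (simp add: fps_compose_mult_distrib fps_compose_power [symmetric])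
  then show ?thesis
    unfolding trunc_bell_gf_def u_def [symmetric] H_def [symmetric]
    by (metis (no_types, lifting) mult.assoc mult.left_commute)
qed

end

theory Submission
  imports Defs
begin

text \<open>
  Write \<open>D\<close> for the derivation \<open>(1 + lam t) d/dt\<close>. It multiplies \<open>deg_exp lam x\<close> by \<open>x\<close>, and the
  outer series \<open>H\<^sub>p = \<Sum>k. X^k / (k + p)!\<close> satisfy \<open>H\<^sub>p' = H\<^sub>p - p H\<^sub>p\<^sub>+\<^sub>1\<close>. Applying \<open>D\<close> to the generating
  function \<open>G\<^sub>p\<close> therefore gives
  \<open>D G\<^sub>p = x G\<^sub>p + e (G\<^sub>p - p / (p + 1) G\<^sub>p\<^sub>+\<^sub>1)\<close> with \<open>e = deg_exp lam 1\<close>; the recurrence is the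
  comparison of coefficients.
\<close>

lemma deg_falling_Suc:
  "deg_falling lam x (Suc n) = (x - of_nat n * lam) * deg_falling lam x n"
  by (simp add: deg_falling_def)

text \<open>The term with \<open>c * of_nat n\<close> is the source of \<open>- n * lam\<close> in
  the recurrence. At \<open>n = 0\<close>, where \<open>fps_X\<close> shifts in a zero coefficient,
  the factor \<open>of_nat n\<close> vanishes too.\<close>

lemma fps_nth_one_plus_X_mult_deriv:
  fixes f :: "'a::comm_ring_1 fps"
  shows "fps_nth ((1 + fps_const c * fps_X) * fps_deriv f) n =
    of_nat (Suc n) * fps_nth f (Suc n) + c * of_nat n * fps_nth f n"
  by (cases n) (simp_all add: distrib_right mult.assoc)

text \<open>In coefficients this is \<open>deg_falling_Suc\<close>, with the part containing
  \<open>n * lam\<close> moved to the left.\<close>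

lemma deg_exp_ode:
  "(1 + fps_const lam * fps_X) * fps_deriv (deg_exp lam x) = fps_const x * deg_exp lam x"
proof (rule fps_ext)
  fix n
  have "real (Suc n) * fps_nth (deg_exp lam x) (Suc n) = deg_falling lam x (Suc n) / fact n"
    by (simp add: deg_exp_def del: of_nat_Suc)
  then show "fps_nth ((1 + fps_const lam * fps_X) * fps_deriv (deg_exp lam x)) n =
      fps_nth (fps_const x * deg_exp lam x) n"
    unfolding fps_nth_one_plus_X_mult_deriv
    by (simp add: deg_exp_def deg_falling_Suc field_simps)
qed

text \<open>Coefficientwise, (k+1)/(k+p+1)! = ((k+p+1) - p)/(k+p+1)! = 1/(k+p)! -
  p/(k+p+1)!.\<close>

lemma fps_deriv_exp_tail:
  "fps_deriv (Abs_fps (\<lambda>k. 1 / fact (k + p) :: real)) =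
    Abs_fps (\<lambda>k. 1 / fact (k + p)) - fps_const (of_nat p) * Abs_fps (\<lambda>k. 1 / fact (k + (p + 1)))"
proof (rule fps_ext)
  fix k
  have "fact (k + (p + 1)) = (real k + real p + 1) * fact (k + p)"
    by simp
  then show "fps_nth (fps_deriv (Abs_fps (\<lambda>k. 1 / fact (k + p) :: real))) k =
    fps_nth (Abs_fps (\<lambda>k. 1 / fact (k + p)) -
      fps_const (of_nat p) * Abs_fps (\<lambda>k. 1 / fact (k + (p + 1)))) k"
    by (simp add: divide_simps)
qed

lemma trunc_bell_gf_ode:
  "(1 + fps_const lam * fps_X) * fps_deriv (trunc_bell_gf lam p x) =
    fps_const x * trunc_bell_gf lam p x +
    deg_exp lam 1 * (trunc_bell_gf lam p x -
      fps_const (of_nat p / (of_nat p + 1)) * trunc_bell_gf lam (p + 1) x)"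
proof -
  define e E u w where "e = deg_exp lam 1" and "E = deg_exp lam x"
    and "u = deg_exp lam 1 - 1" and "w = 1 + fps_const lam * fps_X"
  define H :: "nat \<Rightarrow> real fps" where "H = (\<lambda>q. Abs_fps (\<lambda>k. 1 / fact (k + q)))"
  have gf: "trunc_bell_gf lam q x = fps_const (fact q) * (H q oo u) * E" for q
    by (simp add: trunc_bell_gf_def H_def u_def E_def)
  have u0: "fps_nth u 0 = 0"
    unfolding u_def by (rule deg_exp_1_minus_1_nth_0)
  \<comment> \<open>The constant 1 in \<open>u\<close> disappears under the derivative, so this is
    the equation for \<open>deg_exp\<close> at \<open>x = 1\<close>.\<close>
  have wu: "w * fps_deriv u = e"
    using deg_exp_ode[of lam 1] by (simp add: u_def w_def e_def)
  have wE: "w * fps_deriv E = fps_const x * E"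
    unfolding w_def E_def by (rule deg_exp_ode)
  have "fps_deriv (H p oo u) = (fps_deriv (H p) oo u) * fps_deriv u"
    using u0 by (rule fps_compose_deriv)
  also have "fps_deriv (H p) oo u = (H p oo u) - fps_const (of_nat p) * (H (p + 1) oo u)"
    unfolding H_def fps_deriv_exp_tail
    by (simp add: fps_compose_sub_distrib fps_compose_mult_distrib[OF u0])
  finally have dH: "fps_deriv (H p oo u) =
    ((H p oo u) - fps_const (of_nat p) * (H (p + 1) oo u)) * fps_deriv u" .
  \<comment> \<open>The factor p/(p+1) arises because the generating function for p + 1 is
    normalised by (p+1)! rather than p!.\<close>
  have c: "fps_const (of_nat p / (of_nat p + 1)) * fps_const (fact (p + 1)) =
      fps_const (of_nat p) * (fps_const (fact p) :: real fps)"
  proof -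
    have "real p / (real p + 1) * fact (p + 1) = real p * fact p"
      by (simp add: add.commute[of 1])
    then show ?thesis
      by (simp only: fps_const_mult)
  qed
  \<comment> \<open>Product rule, with \<open>w\<close> attached to each remaining derivative so
    that \<open>wE\<close> and \<open>wu\<close> apply.\<close>
  have "w * fps_deriv (trunc_bell_gf lam p x) =
      fps_const (fact p) * (H p oo u) * (w * fps_deriv E) +
      fps_const (fact p) * ((H p oo u) - fps_const (of_nat p) * (H (p + 1) oo u)) *
        (w * fps_deriv u) * E"
    unfolding gf by (simp add: dH algebra_simps del: fps_const_mult)
  also have "\<dots> = fps_const x * trunc_bell_gf lam p x + e * (trunc_bell_gf lam p x -
      (fps_const (of_nat p) * fps_const (fact p)) * (H (p + 1) oo u) * E)"
    unfolding gf wu wE by (simp add: algebra_simps del: fps_const_mult)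
  finally show ?thesis
    unfolding c[symmetric] by (simp add: gf e_def w_def mult.assoc del: fps_const_mult)
qed

text \<open>Binomial convolution for exponential generating functions: n!/(j! (n-j)!) is the
  binomial coefficient.\<close>

lemma fact_times_nth_deg_exp_mult:
  "fact n * fps_nth (deg_exp lam x * f) n =
    (\<Sum>j = 0..n. of_nat (n choose j) * deg_falling lam x (n - j) * (fact j * fps_nth f j))"
proof -
  have "fact n * fps_nth (deg_exp lam x * f) n =
      (\<Sum>j = 0..n. fact n * (fps_nth f j * (deg_falling lam x (n - j) / fact (n - j))))"
    by (subst mult.commute[of "deg_exp lam x"])
      (simp add: fps_mult_nth deg_exp_def sum_distrib_left)
  also have "\<dots> = (\<Sum>j = 0..n. of_nat (n choose j) * deg_falling lam x (n - j) *
      (fact j * fps_nth f j))"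
    by (intro sum.cong refl) (simp add: binomial_fact field_simps)
  finally show ?thesis .
qed

theorem theorem16:
  fixes lam x :: real and n p :: nat
  shows "trunc_bell lam p (n + 1) x =
    (x - of_nat n * lam) * trunc_bell lam p n x -
    (\<Sum>j = 0..n. of_nat (n choose j) * deg_falling lam 1 (n - j) *
       (of_nat p / (of_nat p + 1) * trunc_bell lam (p + 1) j x - trunc_bell lam p j x))"
proof -
  define c where "c = real p / (real p + 1)"
  define G where "G = (\<lambda>q. trunc_bell_gf lam q x)"
  have B: "trunc_bell lam q m x = fact m * fps_nth (G q) m" for q m
    by (simp add: trunc_bell_def G_def)
  \<comment> \<open>Coefficient n of the differential equation, scaled by n!; since n! (n+1) =
    (n+1)!, the first summand is \<open>trunc_bell lam p (n + 1) x\<close>.\<close>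
  have "fact n * (real (Suc n) * fps_nth (G p) (Suc n) + lam * real n * fps_nth (G p) n) =
      x * (fact n * fps_nth (G p) n) +
      fact n * fps_nth (deg_exp lam 1 * (G p - fps_const c * G (p + 1))) n"
    unfolding fps_nth_one_plus_X_mult_deriv[symmetric] G_def c_def trunc_bell_gf_ode
    by (simp add: algebra_simps)
  also have "fact n * fps_nth (deg_exp lam 1 * (G p - fps_const c * G (p + 1))) n =
      - (\<Sum>j = 0..n. of_nat (n choose j) * deg_falling lam 1 (n - j) *
          (c * trunc_bell lam (p + 1) j x - trunc_bell lam p j x))"
    unfolding fact_times_nth_deg_exp_mult sum_negf[symmetric]
    by (intro sum.cong refl) (simp add: B algebra_simps)
  finally show ?thesis
    unfolding c_def[symmetric] by (simp add: B algebra_simps)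
qed

end
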